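(* There is an absolute constant $K$ such that for every $n\ge 2$ there exists a distribution $\mathcal{D}$ over infinite walk schedules over $[n]$ such that, if $\mathbf{x},\mathbf{y}$ are drawn independently from $\mathcal{D}$ and $\pi$ is a uniformly random permutation of $[n]$ independent of them, then $\Pr(\tau\le 4n)\ge 1-K/\log n$, where $\tau=\min\{t: x_t=\pi(y_t)\}$.
   Context: Rendezvous on the complete graph $K_n$: there are $n$ locations; each of two players labels them privately by $[n]$, and the labelings differ by a uniformly random permutation $\pi$ of $[n]$. A walk schedule is a sequence of labels; a player with schedule $\mathbf{x}$ visits at step $t$ the location she labels $x_t$, and the players meet at step $t$ iff $x_t=\pi(y_t)$. A symmetric strategy is one in which both players independently sample their schedules from the same distribution $\mathcal{D}$. *)

theory Defs
  imports "HOL-Probability.Probability" "HOL-Combinatorics.Permutations"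
begin

text \<open>Steps are numbered from 1, so that \<open>\<tau> \<le> 4 n\<close> refers to the first \<open>4 n\<close> steps.\<close>

definition schedule_space :: "nat \<Rightarrow> (nat \<Rightarrow> nat) measure" where
  "schedule_space n = (\<Pi>\<^sub>M t\<in>{1..}. count_space {1..n})"

definition relabeling :: "nat \<Rightarrow> (nat \<Rightarrow> nat) measure" where
  "relabeling n = uniform_count_measure {\<pi>. \<pi> permutes {1..n}}"

text \<open>The value is \<open>\<infinity>\<close>, the infimum of the empty set, if the players never meet.\<close>

definition meeting_time :: "(nat \<Rightarrow> nat) \<Rightarrow> (nat \<Rightarrow> nat) \<Rightarrow> (nat \<Rightarrow> nat) \<Rightarrow> enat" where
  "meeting_time x y \<pi> = (INF t\<in>{t. 1 \<le> t \<and> x t = \<pi> (y t)}. enat t)"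

end

theory Submission
  imports Defs
begin

text \<open>
  Index time by pairs \<open>(u, S)\<close>, where \<open>u < q\<close> and \<open>S\<close> is a subset of a set \<open>N\<close> of \<open>k + 2\<close> types.
  A player of type \<open>i\<close> waits at a fixed random label whenever \<open>i \<in> S\<close>, and otherwise tours,
  visiting the same label at \<open>(u, S)\<close> and at \<open>(u, N - {i} - S)\<close>.  Exactly one of these two sets
  contains a given \<open>j \<noteq> i\<close>, so a player of type \<open>i\<close> visits all \<open>q 2\<^sup>k\<close> tour labels while a player of
  type \<open>j\<close> waits.  This takes \<open>4 q 2\<^sup>k\<close> steps, so \<open>q = n div 2\<^sup>k\<close> is allowed, and the players can only
  fail to meet if their types agree or if the waiting label is one of the \<open>n mod 2\<^sup>k\<close> labels that
  are not toured.  With \<open>4\<^sup>k \<le> n < 4\<^sup>k\<^sup>+\<^sup>1\<close> both events have probability \<open>O(1 / log n)\<close>.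
\<close>

section \<open>Combinatorial construction of the tours\<close>

lemma complementary_tours:
  fixes k q :: nat
  obtains \<phi> :: "nat \<Rightarrow> nat \<times> nat set" and tour :: "nat \<Rightarrow> nat \<Rightarrow> nat"
  where "\<And>i t. i < k + 2 \<Longrightarrow> t \<in> {1..4 * (q * 2 ^ k)} \<Longrightarrow> i \<notin> snd (\<phi> t) \<Longrightarrow> tour i t \<in> {1..q * 2 ^ k}"
    and "\<And>i j c. \<lbrakk>i < k + 2; j < k + 2; i \<noteq> j; c \<in> {1..q * 2 ^ k}\<rbrakk> \<Longrightarrow>
           \<exists>t\<in>{1..4 * (q * 2 ^ k)}. i \<notin> snd (\<phi> t) \<and> j \<in> snd (\<phi> t) \<and> tour i t = c"
proof -
  define N where "N = {..<k + 2}"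
  have N: "finite N" "card N = k + 2" by (auto simp: N_def)
  have "card {1..4 * (q * 2 ^ k)} = card ({..<q} \<times> Pow N)"
    by (simp add: N card_Pow card_cartesian_product)
  then obtain \<phi> where \<phi>: "bij_betw \<phi> {1..4 * (q * 2 ^ k)} ({..<q} \<times> Pow N)"
    using finite_same_card_bij[of "{1..4 * (q * 2 ^ k)}" "{..<q} \<times> Pow N"] N by auto
  \<comment> \<open>\<open>l i\<close> is a reference type other than \<open>i\<close>; it exists
    even for \<open>k = 0\<close> because there are \<open>k + 2\<close> types. Of \<open>S\<close>
    and \<open>N - {i} - S\<close>, exactly one omits \<open>l i\<close>, so each complementary pair
    is represented by one subset of \<open>N - {i, l i}\<close>, and there are \<open>2 ^ k\<close>
    pairs for each \<open>u\<close>.\<close>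
  define l where "l i = (if i = 0 then 1 else 0 :: nat)" for i :: nat
  have l: "l i \<in> N" "l i \<noteq> i" for i by (auto simp: l_def N_def)
  define C where "C i = {..<q} \<times> Pow (N - {i, l i})" for i
  have "\<exists>h. bij_betw h (C i) {1..q * 2 ^ k}" if "i \<in> N" for i
  proof -
    have "card (N - {i, l i}) = k"
      using that l[of i] N by (simp add: card_Diff_subset)
    then show ?thesis
      using N by (intro finite_same_card_bij) (auto simp: C_def card_Pow card_cartesian_product)
  qed
  then obtain h where h: "\<And>i. i \<in> N \<Longrightarrow> bij_betw (h i) (C i) {1..q * 2 ^ k}" by metis
  \<comment> \<open>For \<open>i \<notin> S\<close>, \<open>can i\<close> takes the same value on
    both members of a pair, so factoring \<open>tour i\<close> through it repeats each label on
    complementary sets.\<close>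
  define can where "can i S = (if l i \<in> S then N - {i} - S else S)" for i S
  define tour where "tour i t = h i (fst (\<phi> t), can i (snd (\<phi> t)))" for i t
  show ?thesis
  proof
    fix i t assume *: "i < k + 2" "t \<in> {1..4 * (q * 2 ^ k)}" "i \<notin> snd (\<phi> t)"
    have "\<phi> t \<in> {..<q} \<times> Pow N" using \<phi> *(2) by (rule bij_betwE[rule_format])
    then have "(fst (\<phi> t), can i (snd (\<phi> t))) \<in> C i"
      using *(3) by (auto simp: C_def can_def)
    then show "tour i t \<in> {1..q * 2 ^ k}"
      unfolding tour_def using h[of i] *(1) by (auto simp: N_def dest!: bij_betwE)
  next
    fix i j c assume *: "i < k + 2" "j < k + 2" "i \<noteq> j" "c \<in> {1..q * 2 ^ k}"
    have "c \<in> h i ` C i" using h[of i] * by (auto simp: N_def bij_betw_def)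
    then obtain u R where R: "u < q" "R \<subseteq> N - {i, l i}" "c = h i (u, R)"
      by (auto simp: C_def)
    \<comment> \<open>The pair of \<open>R\<close> is visited at both members; \<open>S\<close> is
      the one at which type \<open>j\<close> waits.\<close>
    define S where "S = (if j \<in> R then R else N - {i} - R)"
    have S: "j \<in> S" "i \<notin> S" "S \<subseteq> N" "can i S = R"
      using R(2) * l[of i] by (auto simp: S_def can_def N_def)
    have "(u, S) \<in> \<phi> ` {1..4 * (q * 2 ^ k)}"
      using \<phi> R(1) S(3) by (auto simp: bij_betw_def)
    then obtain t where "t \<in> {1..4 * (q * 2 ^ k)}" "\<phi> t = (u, S)" by force
    then show "\<exists>t\<in>{1..4 * (q * 2 ^ k)}. i \<notin> snd (\<phi> t) \<and> j \<in> snd (\<phi> t) \<and> tour i t = c"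
      using S R(3) by (intro bexI[of _ t]) (auto simp: tour_def)
  qed
qed

section \<open>Bounded meeting times and products of discrete distributions\<close>

lemma meeting_time_le_iff:
  "meeting_time x y \<pi> \<le> enat N \<longleftrightarrow> (\<exists>t\<in>{1..N}. x t = \<pi> (y t))"
proof -
  \<comment> \<open>A strict upper bound on an infimum yields a witness directly, without arguing
    that the infimum is attained.\<close>
  have "meeting_time x y \<pi> \<le> enat N \<longleftrightarrow> meeting_time x y \<pi> < enat (Suc N)"
    by (cases "meeting_time x y \<pi>") auto
  then show ?thesis
    unfolding meeting_time_def by (auto simp: INF_less_iff less_Suc_eq_le)
qed

text \<open>Preimages of rectangles are rectangles, on which \<open>pair_pmf\<close> is
  multiplicative, and rectangles determine the product measure. This moves probabilities on schedule
  spaces to discrete ones.\<close>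

lemma pair_measure_distr_pmf:
  fixes p :: "'a pmf" and q :: "'b pmf"
  assumes f: "f \<in> measure_pmf p \<rightarrow>\<^sub>M M" and g: "g \<in> measure_pmf q \<rightarrow>\<^sub>M N"
  shows "distr (measure_pmf p) M f \<Otimes>\<^sub>M distr (measure_pmf q) N g =
    distr (measure_pmf (pair_pmf p q)) (M \<Otimes>\<^sub>M N) (map_prod f g)"
proof (rule pair_measure_eqI)
  interpret P: prob_space "distr (measure_pmf p) M f"
    by (rule measure_pmf.prob_space_distr[OF f])
  interpret Q: prob_space "distr (measure_pmf q) N g"
    by (rule measure_pmf.prob_space_distr[OF g])
  show "sigma_finite_measure (distr (measure_pmf p) M f)" by unfold_locales
  show "sigma_finite_measure (distr (measure_pmf q) N g)" by unfold_locales
  show "sets (distr (measure_pmf p) M f \<Otimes>\<^sub>M distr (measure_pmf q) N g) =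
    sets (distr (measure_pmf (pair_pmf p q)) (M \<Otimes>\<^sub>M N) (map_prod f g))"
    by (simp cong: sets_pair_measure_cong)
next
  fix A B assume "A \<in> sets (distr (measure_pmf p) M f)" "B \<in> sets (distr (measure_pmf q) N g)"
  then have A: "A \<in> sets M" and B: "B \<in> sets N" by auto
  have fg: "map_prod f g \<in> measure_pmf (pair_pmf p q) \<rightarrow>\<^sub>M M \<Otimes>\<^sub>M N"
    using f g by (auto simp: measurable_def space_pair_measure Pi_def)
  have "emeasure (measure_pmf (pair_pmf p q)) ((f -` A) \<times> (g -` B)) =
    emeasure (measure_pmf p) (f -` A) * emeasure (measure_pmf q) (g -` B)"
  proof -
    have "emeasure (measure_pmf (pair_pmf p q)) ((f -` A) \<times> (g -` B)) =
      (\<integral>\<^sup>+ x. \<integral>\<^sup>+ y. indicator (f -` A) x * indicator (g -` B) y \<partial>measure_pmf q \<partial>measure_pmf p)"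
      by (simp flip: nn_integral_indicator add: nn_integral_pair_pmf' indicator_times)
    then show ?thesis by (simp add: nn_integral_cmult nn_integral_multc)
  qed
  moreover have "map_prod f g -` (A \<times> B) = (f -` A) \<times> (g -` B)" by auto
  ultimately show "emeasure (distr (measure_pmf p) M f) A * emeasure (distr (measure_pmf q) N g) B =
    emeasure (distr (measure_pmf (pair_pmf p q)) (M \<Otimes>\<^sub>M N) (map_prod f g)) (A \<times> B)"
    using A B f g fg by (simp add: emeasure_distr)
qed

lemma prob_pair_pmf_le:
  assumes "\<And>x. x \<in> set_pmf p \<Longrightarrow> measure_pmf.prob q {y. Q x y} \<le> c"
  shows "measure_pmf.prob (pair_pmf p q) {(x, y). Q x y} \<le> c"
proof -
  \<comment> \<open>A point of the support forces \<open>0 \<le> c\<close>; otherwise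
    \<open>ennreal c\<close> would truncate to 0 and the bound could not be read back in the
    reals.\<close>
  obtain x0 where "x0 \<in> set_pmf p" using set_pmf_not_empty[of p] by blast
  then have c: "0 \<le> c" using assms[of x0] measure_nonneg order_trans by blast
  have "emeasure (measure_pmf (pair_pmf p q)) {(x, y). Q x y} =
    (\<integral>\<^sup>+ x. \<integral>\<^sup>+ y. indicator {(x, y). Q x y} (x, y) \<partial>measure_pmf q \<partial>measure_pmf p)"
    by (simp flip: nn_integral_indicator add: nn_integral_pair_pmf')
  also have "\<dots> = (\<integral>\<^sup>+ x. emeasure (measure_pmf q) {y. Q x y} \<partial>measure_pmf p)"
    by (simp flip: nn_integral_indicator add: indicator_def)
  also have "\<dots> \<le> (\<integral>\<^sup>+ x. ennreal c \<partial>measure_pmf p)"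
    by (intro nn_integral_mono_AE)
       (auto simp: AE_measure_pmf_iff measure_pmf.emeasure_eq_measure assms ennreal_leI)
  finally show ?thesis
    using c by (simp add: measure_pmf.emeasure_eq_measure)
qed

lemma prob_pair_pmf_le':
  assumes "\<And>y. y \<in> set_pmf q \<Longrightarrow> measure_pmf.prob p {x. Q x y} \<le> c"
  shows "measure_pmf.prob (pair_pmf p q) {(x, y). Q x y} \<le> c"
proof -
  have "(\<lambda>(x, y). (y, x)) -` {(x, y). Q x y} = {(y, x). Q x y}" by auto
  then show ?thesis
    using prob_pair_pmf_le[of q p "\<lambda>y x. Q x y" c] assms
    by (subst pair_commute_pmf) (simp add: measure_map_pmf)
qed

section \<open>Relabelings and measurability of the meeting event\<close>

lemma space_relabeling: "space (relabeling n) = {\<pi>. \<pi> permutes {1..n}}"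
  by (simp add: relabeling_def space_uniform_count_measure)

lemma sets_relabeling: "sets (relabeling n) = Pow {\<pi>. \<pi> permutes {1..n}}"
  by (simp add: relabeling_def sets_uniform_count_measure)

text \<open>The space of \<open>relabeling n\<close> contains only permutations, whereas the pmf
  lives on all functions. The default \<open>id\<close> sends every function into that space, and
  the map is the identity on the support.\<close>

lemma relabeling_eq_distr_pmf:
  "relabeling n = distr (measure_pmf (pmf_of_set {\<pi>. \<pi> permutes {1..n}})) (relabeling n)
     (\<lambda>\<pi>. if \<pi> permutes {1..n} then \<pi> else id)"
  (is "_ = distr (measure_pmf (pmf_of_set ?P)) _ ?f")
proof (rule measure_eqI)
  fix A assume "A \<in> sets (relabeling n)"
  then have A: "A \<subseteq> ?P" by (simp add: sets_relabeling)
  have fin: "finite ?P" "?P \<noteq> {}"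
    by (auto intro: finite_permutations permutes_id)
  have f: "?f \<in> measure_pmf (pmf_of_set ?P) \<rightarrow>\<^sub>M relabeling n"
    by (auto simp: measurable_def sets_relabeling space_relabeling permutes_id)
  have "?P \<inter> ?f -` A = A" using A by auto
  then have "emeasure (distr (measure_pmf (pmf_of_set ?P)) (relabeling n) ?f) A =
      ennreal (real (card A) / real (card ?P))"
    using A f fin
    by (simp add: emeasure_distr sets_relabeling measure_pmf.emeasure_eq_measure measure_pmf_of_set)
  also have "\<dots> = emeasure (relabeling n) A"
    using A fin unfolding relabeling_def
    by (simp add: emeasure_uniform_count_measure)
  finally show "emeasure (relabeling n) A =
    emeasure (distr (measure_pmf (pmf_of_set ?P)) (relabeling n) ?f) A" by simp
qed simp

text \<open>The label \<open>\<pi> (y t)\<close> depends jointly on two random objects, so the event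
  is split into finitely many cases by the values of \<open>t\<close>, \<open>\<pi>\<close> and
  \<open>y t\<close>, each an intersection of coordinate conditions.\<close>

lemma sets_meeting_event:
  "{\<omega> \<in> space (schedule_space n \<Otimes>\<^sub>M schedule_space n \<Otimes>\<^sub>M relabeling n).
     \<exists>t\<in>{1..N}. fst \<omega> t = snd (snd \<omega>) (fst (snd \<omega>) t)}
   \<in> sets (schedule_space n \<Otimes>\<^sub>M schedule_space n \<Otimes>\<^sub>M relabeling n)"
  (is "_ \<in> sets ?M")
proof -
  let ?P = "{\<pi>. \<pi> permutes {1..n}}"
  have comp: "(\<lambda>x. x t) \<in> schedule_space n \<rightarrow>\<^sub>M count_space {1..n}" if "t \<in> {1..}" for t
    unfolding schedule_space_def using that by (rule measurable_component_singleton)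
  have [measurable]: "{\<omega> \<in> space ?M. fst \<omega> t = c} \<in> sets ?M" 
    "{\<omega> \<in> space ?M. fst (snd \<omega>) t = c} \<in> sets ?M" if "t \<in> {1..}" for t c
  proof -
    note [measurable] = comp[OF that]
    have "(\<lambda>\<omega>. fst \<omega> t) \<in> ?M \<rightarrow>\<^sub>M count_space {1..n}"
      "(\<lambda>\<omega>. fst (snd \<omega>) t) \<in> ?M \<rightarrow>\<^sub>M count_space {1..n}" by measurable
    then have "(\<lambda>\<omega>. fst \<omega> t) \<in> ?M \<rightarrow>\<^sub>M count_space UNIV"
      "(\<lambda>\<omega>. fst (snd \<omega>) t) \<in> ?M \<rightarrow>\<^sub>M count_space UNIV"
      by (auto dest: measurable_compose[where g = "\<lambda>c. c" and L = "count_space UNIV"])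
    then show "{\<omega> \<in> space ?M. fst \<omega> t = c} \<in> sets ?M"
      "{\<omega> \<in> space ?M. fst (snd \<omega>) t = c} \<in> sets ?M" by measurable
  qed
  have [measurable]: "{\<omega> \<in> space ?M. snd (snd \<omega>) = \<pi>} \<in> sets ?M" if "\<pi> \<in> ?P" for \<pi>
  proof -
    have "{\<pi>} \<in> sets (relabeling n)" using that by (simp add: sets_relabeling)
    moreover have "(\<lambda>\<omega>. snd (snd \<omega>)) \<in> ?M \<rightarrow>\<^sub>M relabeling n" by measurable
    ultimately have "(\<lambda>\<omega>. snd (snd \<omega>)) -` {\<pi>} \<inter> space ?M \<in> sets ?M"
      by (rule measurable_sets[rotated])
    then show ?thesis by (simp add: vimage_def Int_def conj_commute)
  qed
  have "{\<omega> \<in> space ?M. \<exists>t\<in>{1..N}. fst \<omega> t = snd (snd \<omega>) (fst (snd \<omega>) t)} =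
    (\<Union>t\<in>{1..N}. \<Union>\<pi>\<in>?P. \<Union>c\<in>{1..n}. {\<omega> \<in> space ?M. fst \<omega> t = \<pi> c} \<inter>
      {\<omega> \<in> space ?M. fst (snd \<omega>) t = c} \<inter> {\<omega> \<in> space ?M. snd (snd \<omega>) = \<pi>})"
    by (fastforce simp: space_pair_measure space_relabeling schedule_space_def space_PiM PiE_def Pi_def)
  also have "\<dots> \<in> sets ?M"
    by (intro sets.finite_UN sets.Int finite_permutations) auto
  finally show ?thesis .
qed

section \<open>Failure probability and the schedule distribution\<close>

text \<open>Union bound over a uniform pair of type and waiting label: \<open>n\<close> of the
  \<open>m * n\<close> pairs have type \<open>i\<close>, and by bijectivity of \<open>\<pi>\<close>
  exactly \<open>n - L\<close> labels are sent above \<open>L\<close>. The bound is uniform in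
  \<open>i\<close> and \<open>\<pi>\<close>, so it survives averaging over them.\<close>

lemma prob_same_type_or_untoured_le:
  fixes n m L i :: nat
  assumes "0 < m" "0 < n" "L \<le> n" "\<pi> permutes {1..n}"
  shows "measure_pmf.prob (pmf_of_set ({..<m} \<times> {1..n})) {y. fst y = i \<or> L < \<pi> (snd y)}
    \<le> 1 / m + real (n - L) / n"
proof -
  let ?A = "{..<m} \<times> {1..n}" and ?B = "{b \<in> {1..n}. L < \<pi> b}"
  have "\<pi> ` ?B = {L<..n}"
  proof -
    have "\<pi> ` {1..n} = {1..n}" using assms(4) by (rule permutes_image)
    moreover have "\<pi> ` ?B = \<pi> ` {1..n} \<inter> {L<..}" by auto
    ultimately show ?thesis by auto
  qed
  moreover have "card (\<pi> ` ?B) = card ?B"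
    by (rule card_image) (rule permutes_inj_on[OF assms(4)])
  ultimately have B: "card ?B = n - L" by simp
  have "card (?A \<inter> {y. fst y = i \<or> L < \<pi> (snd y)}) \<le> card ({i} \<times> {1..n} \<union> {..<m} \<times> ?B)"
    by (intro card_mono) auto
  also have "\<dots> \<le> n + m * (n - L)"
    using card_Un_le[of "{i} \<times> {1..n}" "{..<m} \<times> ?B"] B by (simp add: card_cartesian_product)
  finally have le: "card (?A \<inter> {y. fst y = i \<or> L < \<pi> (snd y)}) \<le> n + m * (n - L)" .
  have "?A \<noteq> {}" using assms by auto
  then have "measure_pmf.prob (pmf_of_set ?A) {y. fst y = i \<or> L < \<pi> (snd y)} =
      real (card (?A \<inter> {y. fst y = i \<or> L < \<pi> (snd y)})) / (real m * real n)"
    by (simp add: measure_pmf_of_set card_cartesian_product)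
  also have "\<dots> \<le> real (n + m * (n - L)) / (real m * real n)"
    using le by (intro divide_right_mono) (simp_all only: of_nat_le_iff, simp)
  also have "\<dots> = 1 / m + real (n - L) / n"
    using assms by (simp add: field_simps)
  finally show ?thesis .
qed

text \<open>\<open>D\<close> is the law of the walk of a uniform pair of type and waiting label. In
  the labels of \<open>x\<close>, player \<open>y\<close> waits at \<open>\<pi> (snd y)\<close>; if
  the types differ and this label is at most \<open>L\<close>, the tour of \<open>x\<close> reaches
  it while \<open>y\<close> waits.\<close>

lemma exists_schedule_distribution:
  fixes k n :: nat
  assumes n: "0 < n"
  defines "L \<equiv> n div 2 ^ k * 2 ^ k"
  shows "\<exists>D. prob_space D \<and> sets D = sets (schedule_space n) \<and>
     \<P>((x, y, \<pi>) in D \<Otimes>\<^sub>M D \<Otimes>\<^sub>M relabeling n. meeting_time x y \<pi> \<le> enat (4 * n))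
       \<ge> 1 - (1 / real (k + 2) + real (n - L) / n)"
proof -
  have Ln: "L \<le> n" by (simp add: L_def)
  obtain \<phi> :: "nat \<Rightarrow> nat \<times> nat set" and tour :: "nat \<Rightarrow> nat \<Rightarrow> nat"
    where tour: "\<And>i t. i < k + 2 \<Longrightarrow> t \<in> {1..4 * L} \<Longrightarrow> i \<notin> snd (\<phi> t) \<Longrightarrow> tour i t \<in> {1..L}"
      and cover: "\<And>i j c. \<lbrakk>i < k + 2; j < k + 2; i \<noteq> j; c \<in> {1..L}\<rbrakk> \<Longrightarrow>
           \<exists>t\<in>{1..4 * L}. i \<notin> snd (\<phi> t) \<and> j \<in> snd (\<phi> t) \<and> tour i t = c"
    using complementary_tours[of k "n div 2 ^ k"] unfolding L_def by blast
  define A where "A = {..<k + 2} \<times> {1..n}"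
  have A: "finite A" "A \<noteq> {}" using n by (auto simp: A_def)
  \<comment> \<open>The restriction to \<open>{1..}\<close> gives an extensional function, as the
    product space requires. After step \<open>4 * L\<close> the player stays at her waiting label;
    pairs outside \<open>A\<close> get the constant label 1, so that every walk is a valid
    schedule.\<close>
  define walk where "walk p = (\<lambda>t\<in>{1..}. if p \<in> A \<and> t \<le> 4 * L \<and> fst p \<notin> snd (\<phi> t)
      then tour (fst p) t else if p \<in> A then snd p else 1)" for p :: "nat \<times> nat"
  define p where "p = pmf_of_set A"
  define P where "P = {\<pi>. \<pi> permutes {1..n}}"
  define f where "f = (\<lambda>\<pi>. if \<pi> permutes {1..n} then \<pi> else id)"
  define r where "r = pmf_of_set P"
  have P: "finite P" "P \<noteq> {}"
    by (auto simp: P_def intro: finite_permutations permutes_id)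
  let ?S = "schedule_space n" and ?R = "relabeling n"
  have walk_space: "walk x \<in> space ?S" for x
    using tour[of "fst x"] n Ln by (fastforce simp: walk_def schedule_space_def space_PiM A_def)
  then have walk[measurable]: "walk \<in> measure_pmf p \<rightarrow>\<^sub>M ?S"
    by (auto simp: measurable_def)
  have f_space: "f x \<in> space ?R" for x
    by (auto simp: f_def space_relabeling permutes_id)
  then have f: "f \<in> measure_pmf r \<rightarrow>\<^sub>M ?R" by (auto simp: measurable_def)
  define D where "D = distr (measure_pmf p) ?S walk"
  let ?M = "?S \<Otimes>\<^sub>M ?S \<Otimes>\<^sub>M ?R" and ?g = "map_prod walk (map_prod walk f)"
  have g2: "map_prod walk f \<in> measure_pmf (pair_pmf p r) \<rightarrow>\<^sub>M ?S \<Otimes>\<^sub>M ?R"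
    using walk_space f_space by (auto simp: measurable_def space_pair_measure)
  have g: "?g \<in> measure_pmf (pair_pmf p (pair_pmf p r)) \<rightarrow>\<^sub>M ?M"
    using walk_space f_space by (auto simp: measurable_def space_pair_measure)
  have "?R = distr (measure_pmf r) ?R f"
    unfolding r_def P_def f_def by (rule relabeling_eq_distr_pmf)
  then have DDR: "D \<Otimes>\<^sub>M D \<Otimes>\<^sub>M ?R = distr (measure_pmf (pair_pmf p (pair_pmf p r))) ?M ?g"
    using pair_measure_distr_pmf[OF walk f] pair_measure_distr_pmf[OF walk g2] by (simp add: D_def)
  let ?E = "{\<omega> \<in> space ?M. \<exists>t\<in>{1..4 * n}. fst \<omega> t = snd (snd \<omega>) (fst (snd \<omega>) t)}"
  let ?Bad = "{(x, z). case z of (y, \<pi>) \<Rightarrow> fst y = fst x \<or> L < \<pi> (snd y)}"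
  have meet: "\<exists>t\<in>{1..4 * n}. walk x t = \<pi> (walk y t)"
    if xy: "x \<in> A" "y \<in> A" and \<pi>: "\<pi> \<in> P" and "fst y \<noteq> fst x" "\<pi> (snd y) \<le> L" for x y \<pi>
  proof -
    have "\<pi> (snd y) \<in> {1..n}"
      using \<pi> xy permutes_in_image[of \<pi> "{1..n}" "snd y"] by (auto simp: P_def A_def)
    then have "\<exists>t\<in>{1..4 * L}. fst x \<notin> snd (\<phi> t) \<and> fst y \<in> snd (\<phi> t) \<and> tour (fst x) t = \<pi> (snd y)"
      using that by (intro cover) (auto simp: A_def)
    then obtain t where t: "t \<in> {1..4 * L}" "fst x \<notin> snd (\<phi> t)" "fst y \<in> snd (\<phi> t)"
      "tour (fst x) t = \<pi> (snd y)" by blast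
    then have "walk x t = \<pi> (walk y t)" using xy by (simp add: walk_def)
    with t(1) Ln show ?thesis by (intro bexI[of _ t]) auto
  qed
  have "1 - (1 / real (k + 2) + real (n - L) / n) \<le>
      1 - measure_pmf.prob (pair_pmf p (pair_pmf p r)) ?Bad"
  proof -
    have "measure_pmf.prob (pair_pmf p (pair_pmf p r)) ?Bad \<le> 1 / real (k + 2) + real (n - L) / n"
    \<comment> \<open>First \<open>x\<close> and then \<open>\<pi>\<close> are fixed, leaving only
      \<open>y\<close> random.\<close>
    proof (rule prob_pair_pmf_le, rule prob_pair_pmf_le')
      fix x \<pi> assume "\<pi> \<in> set_pmf r"
      then have "\<pi> permutes {1..n}" using P by (simp add: r_def P_def)
      then show "measure_pmf.prob p {y. fst y = fst x \<or> L < \<pi> (snd y)}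
          \<le> 1 / real (k + 2) + real (n - L) / n"
        unfolding p_def A_def using n Ln by (intro prob_same_type_or_untoured_le) auto
    qed
    then show ?thesis by simp
  qed
  also have "\<dots> = measure_pmf.prob (pair_pmf p (pair_pmf p r)) (- ?Bad)"
    using measure_pmf.prob_compl[of ?Bad "pair_pmf p (pair_pmf p r)"] by (simp add: Compl_eq_Diff_UNIV)
  also have "\<dots> \<le> measure_pmf.prob (pair_pmf p (pair_pmf p r)) (?g -` ?E)"
  \<comment> \<open>The inclusion is checked on the support only, where pairs lie in
    \<open>A\<close> and \<open>f\<close> fixes \<open>\<pi>\<close>.\<close>
  proof (intro measure_pmf.finite_measure_mono_AE)
    have "?g (x, y, \<pi>) \<in> ?E"
      if "x \<in> A" "y \<in> A" "\<pi> \<in> P" "fst y \<noteq> fst x" "\<pi> (snd y) \<le> L" for x y \<pi>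
    proof -
      have "f \<pi> = \<pi>" using that(3) by (simp add: f_def P_def)
      then show ?thesis
        using meet[OF that] walk_space f_space[of \<pi>] by (simp add: space_pair_measure)
    qed
    then have "\<omega> \<in> - ?Bad \<longrightarrow> \<omega> \<in> ?g -` ?E" if "\<omega> \<in> A \<times> A \<times> P" for \<omega>
      using that unfolding vimage_eq by (cases \<omega>) (simp add: not_less)
    then show "AE \<omega> in measure_pmf (pair_pmf p (pair_pmf p r)). \<omega> \<in> - ?Bad \<longrightarrow> \<omega> \<in> ?g -` ?E"
      using A P by (simp add: AE_measure_pmf_iff p_def r_def)
  qed simp
  also have "\<dots> = measure (D \<Otimes>\<^sub>M D \<Otimes>\<^sub>M ?R) ?E"
    unfolding DDR using g sets_meeting_event[of n "4 * n"] by (simp add: measure_distr)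
  also have "?E = {\<omega> \<in> space (D \<Otimes>\<^sub>M D \<Otimes>\<^sub>M ?R). case \<omega> of (x, y, \<pi>) \<Rightarrow>
      meeting_time x y \<pi> \<le> enat (4 * n)}"
    by (auto simp: DDR meeting_time_le_iff)
  finally have "\<P>((x, y, \<pi>) in D \<Otimes>\<^sub>M D \<Otimes>\<^sub>M ?R. meeting_time x y \<pi> \<le> enat (4 * n))
       \<ge> 1 - (1 / real (k + 2) + real (n - L) / n)"
    by (simp add: case_prod_unfold)
  moreover have "prob_space D"
    unfolding D_def by (rule measure_pmf.prob_space_distr[OF walk])
  moreover have "sets D = sets ?S" by (simp add: D_def)
  ultimately show ?thesis by blast
qed

section \<open>Choice of \<open>k\<close> and the logarithmic bound\<close>

theorem theorem4:
  "\<exists>K::real. \<forall>n::nat\<ge>2. \<exists>D :: (nat \<Rightarrow> nat) measure.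
     prob_space D \<and> sets D = sets (schedule_space n) \<and>
     \<P>((x, y, \<pi>) in D \<Otimes>\<^sub>M D \<Otimes>\<^sub>M relabeling n. meeting_time x y \<pi> \<le> enat (4 * n))
       \<ge> 1 - K / ln (real n)"
\<comment> \<open>Each of the two error terms is at most \<open>1 / (k + 1)\<close>, and
  \<open>ln n \<le> (k + 1) * ln 4\<close>; hence the constant.\<close>
proof (rule exI[of _ "2 * ln 4"], intro allI impI)
  fix n :: nat assume n: "2 \<le> n"
  \<comment> \<open>The lower bound keeps \<open>2 ^ k\<close> at most the square root of
    \<open>n\<close>, so the untoured fraction is small; the upper bound makes the number of types
    logarithmic in \<open>n\<close>, so equal types are rare.\<close>
  obtain k where k: "4 ^ k \<le> n" "n < 4 ^ (k + 1)"
    using ex_power_ivl1[of 4 n] n by auto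
  define L where "L = n div 2 ^ k * 2 ^ k"
  have "n - L = n mod 2 ^ k" by (simp add: L_def minus_div_mult_eq_mod)
  then have "real (n - L) \<le> 2 ^ k"
    by (metis less_imp_le mod_less_divisor of_nat_le_iff of_nat_numeral of_nat_power pos2 zero_less_power)
  moreover have "(4::real) ^ k \<le> real n" using k(1) by (metis of_nat_le_iff of_nat_numeral of_nat_power)
  ultimately have "real (n - L) / n \<le> 2 ^ k / 4 ^ k" by (intro frac_le) auto
  also have "\<dots> = 1 / (2::real) ^ k" by (simp add: field_simps flip: power_mult_distrib)
  also have "\<dots> \<le> 1 / real (k + 1)"
  proof (intro divide_left_mono)
    have "k + 1 \<le> 2 ^ k" using less_exp[of k] by linarith
    then show "real (k + 1) \<le> 2 ^ k" by (metis of_nat_le_iff of_nat_numeral of_nat_power)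
  qed auto
  finally have loss: "real (n - L) / n \<le> 1 / real (k + 1)" .
  have "1 / real (k + 2) \<le> 1 / real (k + 1)" by (intro divide_left_mono) auto
  with loss have "1 / real (k + 2) + real (n - L) / n \<le> 2 / real (k + 1)" by simp
  also have "\<dots> \<le> 2 * ln 4 / ln (real n)"
  proof -
    have "ln (real n) \<le> ln (4 ^ (k + 1))"
    proof (rule ln_mono)
      show "real n \<le> 4 ^ (k + 1)"
        using k(2) by (metis less_imp_le of_nat_le_iff of_nat_numeral of_nat_power)
    qed (use n in auto)
    also have "\<dots> = real (k + 1) * ln 4" by (rule ln_realpow)
    finally show ?thesis using n by (simp add: field_simps)
  qed
  finally have "1 - 2 * ln 4 / ln (real n) \<le> 1 - (1 / real (k + 2) + real (n - L) / n)" by simp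
  moreover obtain D where "prob_space D" "sets D = sets (schedule_space n)"
    "\<P>((x, y, \<pi>) in D \<Otimes>\<^sub>M D \<Otimes>\<^sub>M relabeling n. meeting_time x y \<pi> \<le> enat (4 * n))
       \<ge> 1 - (1 / real (k + 2) + real (n - L) / n)"
    using exists_schedule_distribution[of n k] n unfolding L_def by auto
  ultimately show "\<exists>D :: (nat \<Rightarrow> nat) measure.
     prob_space D \<and> sets D = sets (schedule_space n) \<and>
     \<P>((x, y, \<pi>) in D \<Otimes>\<^sub>M D \<Otimes>\<^sub>M relabeling n. meeting_time x y \<pi> \<le> enat (4 * n))
       \<ge> 1 - 2 * ln 4 / ln (real n)"
    by (meson order_trans)
qed

end
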